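(* Consider the time-delay system $\dot x(t)=f(t,x_t,u(t))$ with $f:\mathbb R_{\ge0}\times\mathcal C\times\mathbb R^m\to\mathbb R^n$, under the standing assumptions in the context, and suppose that: (R1) there exist $\gamma\in\mathcal K_\infty$ and a non-decreasing $N:\mathbb R_{\ge0}\to\mathbb R_{>0}$ such that $|f(t,\psi,\mu)|\le N(\|\psi\|)(1+\gamma(|\mu|))$ for all $t\ge0$, $\psi\in\mathcal C$, $\mu\in\mathbb R^m$; (R2) for every $r>0$ and $\varepsilon>0$ there exists $\delta>0$ such that for all $t\ge0$, $|f(t,\psi,\mu)-f(t,\psi,0)|<\varepsilon$ whenever $\|\psi\|\le r$ and $|\mu|\le\delta$; (R3) for all $r>0$ there exists $L=L(r)$ such that $|f(t,\psi,0)-f(t,\varphi,0)|\le L\|\psi-\varphi\|$ for all $t\ge0$ whenever $\|\psi\|\le r$ and $\|\varphi\|\le r$. Let $\gamma$ be given by (R1) and set $\|u\|_\gamma=\int_0^\infty\gamma(|u(s)|)\,ds$. Then for every $r>0$, $\varepsilon>0$ and $T>0$ there exists $\delta=\delta(r,\varepsilon,T)>0$ such that for every $t_0\ge0$, $\psi\in\mathcal C$ and $u\in\mathcal U$ with $\|u\|_\gamma\le\delta$: if $x(\cdot)$ and $z(\cdot)$ are the maximally defined solutions corresponding to initial time $t_0$, initial state $\psi$ and inputs $u$ and $\mathbf 0$, respectively, and if for some $t^*\in[t_0,t_0+T]$ both are defined on $[t_0-\tau,t^*]$ with $\|x_t\|\le r$ and $\|z_t\|\le r$ for all $t\in[t_0,t^*]$,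 then $\|z_t-x_t\|\le\varepsilon$ for all $t\in[t_0,t^*]$.
   Context: $\gamma\in\mathcal K_\infty$ means $\gamma:\mathbb R_{\ge0}\to\mathbb R_{\ge0}$ is continuous, strictly increasing, unbounded, $\gamma(0)=0$. Time-delay system. Fix $\tau\ge0$; $\mathcal C=\mathcal C([-\tau,0],\mathbb R^n)$ is the space of continuous functions with the supremum norm $\|\psi\|=\sup_{s\in[-\tau,0]}|\psi(s)|$ ($|\cdot|$ is the Euclidean norm). For a continuous $x:[t_0-\tau,T)\to\mathbb R^n$ and $t_0\le t<T$, $x_t\in\mathcal C$ is $x_t(s)=x(t+s)$. $\mathcal U$ is the set of locally bounded Lebesgue measurable functions $u:[0,\infty)\to\mathbb R^m$; $\mathbf 0\in\mathcal U$ is the zero input. Standing assumptions: $f(t,\cdot,\cdot)$ is continuous for every $t\ge0$; $f(\cdot,\psi,\mu)$ is Lebesgue measurable for every $(\psi,\mu)$; and for every $t_0\ge0$, $\psi\in\mathcal C$, $u\in\mathcal U$ there is a unique maximally defined continuous $x:[t_0-\tau,t_{(t_0,\psi,u)})\to\mathbb R^n$, $t_{(t_0,\psi,u)}>t_0$, with $x_{t_0}=\psi$, locally absolutely continuous on $[t_0,t_{(t_0,\psi,u)})$ and satisfying $\dot x(t)=f(t,x_t,u(t))$ for almost all $t$ there; this is the solution corresponding to initial time $t_0$, initial state $\psi$ and input $u$. *)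

theory Defs
  imports "HOL-Analysis.Analysis"
begin

definition class_K_inf :: "(real \<Rightarrow> real) \<Rightarrow> bool" where
  "class_K_inf \<gamma> \<longleftrightarrow>
     \<gamma> \<in> {0..} \<rightarrow> {0..} \<and> continuous_on {0..} \<gamma> \<and> strict_mono_on {0..} \<gamma> \<and>
     \<not> bounded (\<gamma> ` {0..}) \<and> \<gamma> 0 = 0"

text \<open>
  The domain \<open>[- \<tau>, 0]\<close> of a state depends on the term \<open>\<tau>\<close>, so states are functions on
  \<open>real\<close> that are \<open>undefined\<close> outside of it. Hence two states are equal iff they agree on
  \<open>[- \<tau>, 0]\<close>, and the value of a functional at a state depends on nothing else.
\<close>
definition states :: "real \<Rightarrow> (real \<Rightarrow> 'a::real_normed_vector) set" where
  "states \<tau> = {\<psi> \<in> extensional {- \<tau>..0}. continuous_on {- \<tau>..0} \<psi>}"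

definition sup_norm :: "real \<Rightarrow> (real \<Rightarrow> 'a::real_normed_vector) \<Rightarrow> real" where
  "sup_norm \<tau> \<psi> = (SUP s\<in>{- \<tau>..0}. norm (\<psi> s))"

definition sup_dist :: "real \<Rightarrow> (real \<Rightarrow> 'a::real_normed_vector) \<Rightarrow> (real \<Rightarrow> 'a) \<Rightarrow> real" where
  "sup_dist \<tau> \<psi> \<phi> = sup_norm \<tau> (\<lambda>s. \<psi> s - \<phi> s)"

text \<open>Joint continuity on \<open>states \<tau> \<times> UNIV\<close>, the first factor carrying the supremum norm.\<close>
definition continuous_in_state_and_input ::
    "real \<Rightarrow> ((real \<Rightarrow> 'a::real_normed_vector) \<Rightarrow> 'b::real_normed_vector
      \<Rightarrow> 'c::real_normed_vector) \<Rightarrow> bool" where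
  "continuous_in_state_and_input \<tau> g \<longleftrightarrow>
     (\<forall>\<psi>\<in>states \<tau>. \<forall>\<mu>. \<forall>\<epsilon>>0. \<exists>\<delta>>0. \<forall>\<phi>\<in>states \<tau>. \<forall>\<nu>.
        sup_dist \<tau> \<phi> \<psi> < \<delta> \<and> norm (\<nu> - \<mu>) < \<delta> \<longrightarrow> norm (g \<phi> \<nu> - g \<psi> \<mu>) < \<epsilon>)"

definition segment :: "real \<Rightarrow> (real \<Rightarrow> 'a) \<Rightarrow> real \<Rightarrow> (real \<Rightarrow> 'a)" where
  "segment \<tau> x t = restrict (\<lambda>s. x (t + s)) {- \<tau>..0}"

text \<open>Inputs are total functions, of which only the values on \<open>[0, \<infinity>)\<close> matter.\<close>
definition inputs :: "(real \<Rightarrow> 'b::euclidean_space) set" where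
  "inputs = {u. u \<in> borel_measurable (lebesgue_on {0..}) \<and> (\<forall>T\<ge>0. bounded (u ` {0..T}))}"

text \<open>\<open>P\<close> is a finite family of nonoverlapping subintervals \<open>(a, b)\<close>, given by their endpoints.\<close>
definition absolutely_continuous_on :: "real set \<Rightarrow> (real \<Rightarrow> 'a::metric_space) \<Rightarrow> bool" where
  "absolutely_continuous_on S g \<longleftrightarrow>
     (\<forall>\<epsilon>>0. \<exists>\<delta>>0. \<forall>P.
        finite P \<and> (\<forall>(a, b)\<in>P. a < b \<and> {a..b} \<subseteq> S) \<and>
        disjoint_family_on (\<lambda>(a, b). {a<..<b}) P \<and> (\<Sum>(a, b)\<in>P. b - a) < \<delta> \<longrightarrow>
        (\<Sum>(a, b)\<in>P. dist (g a) (g b)) < \<epsilon>)"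

text \<open>
  \<open>x\<close> is a solution on \<open>[t\<^sub>0 - \<tau>, e)\<close>, where \<open>e\<close> may be \<open>\<infinity>\<close>. Like states, solutions
  are \<open>undefined\<close> outside of their domain, so that uniqueness can be stated with \<open>\<exists>!\<close>.
\<close>
definition solution_on ::
    "real \<Rightarrow> (real \<Rightarrow> (real \<Rightarrow> 'a::real_normed_vector) \<Rightarrow> 'b \<Rightarrow> 'a) \<Rightarrow> real \<Rightarrow> (real \<Rightarrow> 'a)
      \<Rightarrow> (real \<Rightarrow> 'b) \<Rightarrow> ereal \<Rightarrow> (real \<Rightarrow> 'a) \<Rightarrow> bool" where
  "solution_on \<tau> f t\<^sub>0 \<psi> u e x \<longleftrightarrow>
     ereal t\<^sub>0 < e \<and>
     x \<in> extensional {t. t\<^sub>0 - \<tau> \<le> t \<and> ereal t < e} \<and>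
     continuous_on {t. t\<^sub>0 - \<tau> \<le> t \<and> ereal t < e} x \<and>
     segment \<tau> x t\<^sub>0 = \<psi> \<and>
     (\<forall>b\<ge>t\<^sub>0. ereal b < e \<longrightarrow> absolutely_continuous_on {t\<^sub>0..b} x) \<and>
     (AE t in lebesgue. t\<^sub>0 \<le> t \<and> ereal t < e \<longrightarrow>
        (x has_vector_derivative f t (segment \<tau> x t) (u t)) (at t))"

definition maximal_solution ::
    "real \<Rightarrow> (real \<Rightarrow> (real \<Rightarrow> 'a::real_normed_vector) \<Rightarrow> 'b \<Rightarrow> 'a) \<Rightarrow> real \<Rightarrow> (real \<Rightarrow> 'a)
      \<Rightarrow> (real \<Rightarrow> 'b) \<Rightarrow> ereal \<Rightarrow> (real \<Rightarrow> 'a) \<Rightarrow> bool" where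
  "maximal_solution \<tau> f t\<^sub>0 \<psi> u e x \<longleftrightarrow>
     solution_on \<tau> f t\<^sub>0 \<psi> u e x \<and>
     \<not> (\<exists>e' y. solution_on \<tau> f t\<^sub>0 \<psi> u e' y \<and> e < e' \<and>
           (\<forall>t. t\<^sub>0 - \<tau> \<le> t \<and> ereal t < e \<longrightarrow> y t = x t))"

text \<open>The value may be \<open>\<infinity>\<close>.\<close>
definition gamma_norm :: "(real \<Rightarrow> real) \<Rightarrow> (real \<Rightarrow> 'b::real_normed_vector) \<Rightarrow> ennreal" where
  "gamma_norm \<gamma> u = (\<integral>\<^sup>+ s\<in>{0..}. ennreal (\<gamma> (norm (u s))) \<partial>lebesgue)"

end

theory Submission
  imports Defs
begin

text \<open>
  The difference \<open>w = z - x\<close> of the two solutions vanishes up to the initial time and is absolutely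
  continuous afterwards. As long as both states stay in the ball of radius \<open>r\<close>, its derivative is
  \<open>f(t, z\<^sub>t, 0) - f(t, x\<^sub>t, u)\<close> almost everywhere. Inserting \<open>f(t, x\<^sub>t, 0)\<close> leaves two
  contributions: a Lipschitz term \<open>L \<parallel>w\<^sub>t\<parallel>\<close>, and the perturbation
  \<open>f(t, x\<^sub>t, u) - f(t, x\<^sub>t, 0)\<close> by the input.
  
  For every \<open>\<eta> > 0\<close> the perturbation is at most \<open>\<eta> + C \<gamma>(|u|)\<close> with a constant \<open>C\<close> that depends only
  on \<open>\<eta>\<close> and \<open>r\<close> (lemma \<open>input_perturbation_bound\<close>). Over a time span \<open>T\<close> its integral is therefore
  at most \<open>\<eta> T + C \<parallel>u\<parallel>\<^sub>\<gamma>\<close>, which is small once \<open>\<eta>\<close> and then \<open>\<delta>\<close> are chosen small. A Gronwall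
  estimate for inequalities that involve the past (lemma \<open>delay_gronwall\<close>) shows that \<open>w\<close> is small.
  
  The passage from the almost everywhere bound on the derivative to a bound on \<open>w\<close> is the fundamental
  theorem of calculus for absolutely continuous functions. It is proved for the Henstock--Kurzweil
  integral, where the derivative is integrable by the very estimate that computes its integral.
\<close>

section \<open>Absolutely continuous functions\<close>

lemma absolutely_continuous_on_subset:
  "absolutely_continuous_on S g \<Longrightarrow> T \<subseteq> S \<Longrightarrow> absolutely_continuous_on T g"
  unfolding absolutely_continuous_on_def split_beta 
proof (intro allI impI)
  fix \<epsilon> :: real
  assume T: "T \<subseteq> S" and "\<epsilon> > 0"
    and "\<forall>\<epsilon>>0. \<exists>\<delta>>0. \<forall>P. finite P \<and> (\<forall>p\<in>P. fst p < snd p \<and> {fst p..snd p} \<subseteq> S) \<and>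
        disjoint_family_on (\<lambda>p. {fst p<..<snd p}) P \<and> (\<Sum>p\<in>P. snd p - fst p) < \<delta> \<longrightarrow>
        (\<Sum>p\<in>P. dist (g (fst p)) (g (snd p))) < \<epsilon>"
  then obtain d where "d > 0" and
    d: "\<And>P. finite P \<and> (\<forall>p\<in>P. fst p < snd p \<and> {fst p..snd p} \<subseteq> S) \<and>
        disjoint_family_on (\<lambda>p. {fst p<..<snd p}) P \<and> (\<Sum>p\<in>P. snd p - fst p) < d \<Longrightarrow>
        (\<Sum>p\<in>P. dist (g (fst p)) (g (snd p))) < \<epsilon>"
    by blast
  show "\<exists>\<delta>>0. \<forall>P. finite P \<and> (\<forall>p\<in>P. fst p < snd p \<and> {fst p..snd p} \<subseteq> T) \<and>
        disjoint_family_on (\<lambda>p. {fst p<..<snd p}) P \<and> (\<Sum>p\<in>P. snd p - fst p) < \<delta> \<longrightarrow>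
        (\<Sum>p\<in>P. dist (g (fst p)) (g (snd p))) < \<epsilon>"
  proof (intro exI conjI allI impI)
    fix P
    assume "finite P \<and> (\<forall>p\<in>P. fst p < snd p \<and> {fst p..snd p} \<subseteq> T) \<and>
        disjoint_family_on (\<lambda>p. {fst p<..<snd p}) P \<and> (\<Sum>p\<in>P. snd p - fst p) < d"
    then show "(\<Sum>p\<in>P. dist (g (fst p)) (g (snd p))) < \<epsilon>"
      using T by (intro d) (meson order.trans)
  qed fact
qed

lemma absolutely_continuous_on_diff:
  fixes g h :: "real \<Rightarrow> 'a::real_normed_vector"
  assumes g: "absolutely_continuous_on S g" and h: "absolutely_continuous_on S h"
  shows "absolutely_continuous_on S (\<lambda>t. g t - h t)"
  unfolding absolutely_continuous_on_def
proof (intro allI impI)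
  fix \<epsilon> :: real assume "\<epsilon> > 0"
  then have e2: "\<epsilon> / 2 > 0" by simp
  obtain d1 where d1: "d1 > 0"
    "\<And>P. finite P \<Longrightarrow> \<forall>(a, b)\<in>P. a < b \<and> {a..b} \<subseteq> S \<Longrightarrow> disjoint_family_on (\<lambda>(a, b). {a<..<b}) P \<Longrightarrow>
      (\<Sum>(a, b)\<in>P. b - a) < d1 \<Longrightarrow> (\<Sum>(a, b)\<in>P. dist (g a) (g b)) < \<epsilon> / 2"
    using g e2 unfolding absolutely_continuous_on_def by meson
  obtain d2 where d2: "d2 > 0"
    "\<And>P. finite P \<Longrightarrow> \<forall>(a, b)\<in>P. a < b \<and> {a..b} \<subseteq> S \<Longrightarrow> disjoint_family_on (\<lambda>(a, b). {a<..<b}) P \<Longrightarrow>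
      (\<Sum>(a, b)\<in>P. b - a) < d2 \<Longrightarrow> (\<Sum>(a, b)\<in>P. dist (h a) (h b)) < \<epsilon> / 2"
    using h e2 unfolding absolutely_continuous_on_def by meson
  show "\<exists>\<delta>>0. \<forall>P. finite P \<and> (\<forall>(a, b)\<in>P. a < b \<and> {a..b} \<subseteq> S) \<and>
      disjoint_family_on (\<lambda>(a, b). {a<..<b}) P \<and> (\<Sum>(a, b)\<in>P. b - a) < \<delta> \<longrightarrow>
      (\<Sum>(a, b)\<in>P. dist (g a - h a) (g b - h b)) < \<epsilon>"
  proof (intro exI conjI allI impI)
    show "min d1 d2 > 0" using d1 d2 by simp
    fix P assume P: "finite P \<and> (\<forall>(a, b)\<in>P. a < b \<and> {a..b} \<subseteq> S) \<and>
      disjoint_family_on (\<lambda>(a, b). {a<..<b}) P \<and> (\<Sum>(a, b)\<in>P. b - a) < min d1 d2"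
    have "(\<Sum>(a, b)\<in>P. dist (g a - h a) (g b - h b))
        \<le> (\<Sum>(a, b)\<in>P. dist (g a) (g b) + dist (h a) (h b))"
      unfolding split_beta
    proof (rule sum_mono)
      fix p
      have "(g (fst p) - h (fst p)) - (g (snd p) - h (snd p)) =
          (g (fst p) - g (snd p)) - (h (fst p) - h (snd p))" by simp
      then show "dist (g (fst p) - h (fst p)) (g (snd p) - h (snd p))
          \<le> dist (g (fst p)) (g (snd p)) + dist (h (fst p)) (h (snd p))"
        by (metis dist_norm norm_triangle_ineq4)
    qed
    also have "\<dots> = (\<Sum>(a, b)\<in>P. dist (g a) (g b)) + (\<Sum>(a, b)\<in>P. dist (h a) (h b))"
      by (simp add: split_beta sum.distrib)
    also have "\<dots> < \<epsilon>" using d1(2)[of P] d2(2)[of P] P by simp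
    finally show "(\<Sum>(a, b)\<in>P. dist (g a - h a) (g b - h b)) < \<epsilon>" .
  qed
qed

lemma absolutely_continuous_on_imp_continuous_on:
  assumes "absolutely_continuous_on {a..b} g"
  shows "continuous_on {a..b} g"
  unfolding continuous_on_iff
proof (intro ballI allI impI)
  fix t and \<epsilon> :: real assume t: "t \<in> {a..b}" and "\<epsilon> > 0"
  then obtain d where d: "d > 0"
    "\<And>P. finite P \<Longrightarrow> \<forall>(u, v)\<in>P. u < v \<and> {u..v} \<subseteq> {a..b} \<Longrightarrow> disjoint_family_on (\<lambda>(u, v). {u<..<v}) P \<Longrightarrow>
      (\<Sum>(u, v)\<in>P. v - u) < d \<Longrightarrow> (\<Sum>(u, v)\<in>P. dist (g u) (g v)) < \<epsilon>"
    using assms unfolding absolutely_continuous_on_def by meson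
  have "dist (g s) (g t) < \<epsilon>" if s: "s \<in> {a..b}" "dist s t < d" for s
  proof (cases s t rule: linorder_cases)
    case less
    then show ?thesis
      using d(2)[of "{(s, t)}"] s t by (simp add: disjoint_family_on_def dist_real_def)
  next
    case greater
    then show ?thesis
      using d(2)[of "{(t, s)}"] s t
      by (simp add: disjoint_family_on_def dist_real_def dist_commute)
  qed (use \<open>\<epsilon> > 0\<close> in simp)
  then show "\<exists>d>0. \<forall>s\<in>{a..b}. dist s t < d \<longrightarrow> dist (g s) (g t) < \<epsilon>" using d(1) by blast
qed

section \<open>The fundamental theorem of calculus for absolutely continuous functions\<close>

lemma negligible_outer_open:
  fixes S :: "'a::euclidean_space set"
  assumes "negligible S" "d > 0"
  obtains U where "open U" "S \<subseteq> U" "U \<in> lmeasurable" "measure lebesgue U < d"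
proof -
  have S: "S \<in> sets lebesgue" "S \<in> null_sets lebesgue"
    using assms(1) negligible_iff_null_sets by blast+
  obtain U where U: "open U" "S \<subseteq> U" "U - S \<in> lmeasurable" "emeasure lebesgue (U - S) < ennreal d"
    using sets_lebesgue_outer_open[OF S(1) assms(2)] by blast
  have "emeasure lebesgue U = emeasure lebesgue (U - S)"
    using S(2) U(1) by (simp add: emeasure_Diff_null_set)
  then have "emeasure lebesgue U < ennreal d" using U by simp
  moreover from this have "U \<in> lmeasurable"
    using U(1) by (intro fmeasurableI) (auto intro: less_trans)
  ultimately show thesis
    using that[of U] U assms(2) by (simp add: emeasure_eq_measure2 ennreal_less_iff)
qed

text \<open>
  Absolute continuity makes the increments over a null set harmless: choose \<open>U\<close> of measure below
  the \<open>\<delta>\<close> that belongs to \<open>\<epsilon>\<close>. The intervals of \<open>p\<close> do not overlap and lie in \<open>U\<close>, so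
  their total length is below \<open>\<delta>\<close>.
\<close>
lemma absolutely_continuous_on_small_on_null_tags:
  fixes g :: "real \<Rightarrow> 'a::real_normed_vector"
  assumes ac: "absolutely_continuous_on {a..b} g" and S: "negligible S" and "\<epsilon> > 0"
  shows "\<exists>U. open U \<and> S \<subseteq> U \<and>
    (\<forall>p. p tagged_partial_division_of {a..b} \<and> (\<forall>(t, K)\<in>p. K \<subseteq> U) \<longrightarrow>
      (\<Sum>(t, K)\<in>p. norm (g (Sup K) - g (Inf K))) < \<epsilon>)"
proof -
  obtain d where d: "d > 0"
    "\<And>P. finite P \<Longrightarrow> \<forall>(u, v)\<in>P. u < v \<and> {u..v} \<subseteq> {a..b} \<Longrightarrow> disjoint_family_on (\<lambda>(u, v). {u<..<v}) P \<Longrightarrow>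
      (\<Sum>(u, v)\<in>P. v - u) < d \<Longrightarrow> (\<Sum>(u, v)\<in>P. dist (g u) (g v)) < \<epsilon>"
    using ac \<open>\<epsilon> > 0\<close> unfolding absolutely_continuous_on_def by meson
  obtain U where U: "open U" "S \<subseteq> U" "U \<in> lmeasurable" "measure lebesgue U < d"
    using negligible_outer_open[OF S d(1)] .
  have "(\<Sum>(t, K)\<in>p. norm (g (Sup K) - g (Inf K))) < \<epsilon>"
    if p: "p tagged_partial_division_of {a..b}" and pU: "\<forall>(t, K)\<in>p. K \<subseteq> U" for p
  proof -
    note tpd = tagged_partial_division_ofD[OF p]
    have K: "Inf K \<le> Sup K \<and> K = {Inf K..Sup K}" if "(t, K) \<in> p" for t K
      using tpd(2,4)[OF that] by (force simp: cbox_interval)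
    \<comment> \<open>Degenerate intervals contribute nothing and are dropped: absolute continuity speaks of
      intervals with distinct endpoints, and only those have disjoint interiors that tell them
      apart, which makes the passage from \<open>q\<close> to the set of endpoint pairs injective.\<close>
    define q where "q = {(t, K) \<in> p. Inf K < Sup K}"
    define ends :: "real \<times> real set \<Rightarrow> real \<times> real" where "ends = (\<lambda>(t, K). (Inf K, Sup K))"
    have q: "finite q" "q \<subseteq> p" using tpd(1) unfolding q_def by (auto intro: finite_subset)
    have disj: "{Inf K<..<Sup K} \<inter> {Inf K'<..<Sup K'} = {}"
      if "(t, K) \<in> p" "(t', K') \<in> p" "(t, K) \<noteq> (t', K')" for t K t' K'
      using tpd(5)[OF that] K[OF that(1)] K[OF that(2)] interior_atLeastAtMost_real by metis
    have inj: "inj_on ends q"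
    proof (rule inj_onI, clarify)
      fix t K t' K' assume "(t, K) \<in> q" "(t', K') \<in> q" "ends (t, K) = ends (t', K')"
      then show "t = t' \<and> K = K'"
        using disj[of t K t' K'] unfolding q_def ends_def by auto
    qed
    have dis: "disjoint_family_on (\<lambda>(u, v). {u<..<v}) (ends ` q)"
      unfolding disjoint_family_on_def
    proof (intro ballI impI)
      fix m n assume "m \<in> ends ` q" "n \<in> ends ` q" "m \<noteq> n"
      then obtain t K t' K' where "(t, K) \<in> p" "(t', K') \<in> p" "(t, K) \<noteq> (t', K')"
        "m = (Inf K, Sup K)" "n = (Inf K', Sup K')"
        using q(2) unfolding ends_def by fastforce
      then show "(case m of (u, v) \<Rightarrow> {u<..<v}) \<inter> (case n of (u, v) \<Rightarrow> {u<..<v}) = {}"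
        using disj by simp
    qed
    have "u < v \<and> {u..v} \<subseteq> {a..b}" if uv: "(u, v) \<in> ends ` q" for u v
    proof -
      obtain t K where tK: "(t, K) \<in> p" "u = Inf K" "v = Sup K" "u < v"
        using uv unfolding q_def ends_def by fastforce
      show ?thesis using tpd(3)[OF tK(1)] K[OF tK(1)] tK(2-4) by metis
    qed
    then have sub: "\<forall>(u, v)\<in>ends ` q. u < v \<and> {u..v} \<subseteq> {a..b}" by blast
    have subU: "{u<..<v} \<subseteq> U" if uv: "(u, v) \<in> ends ` q" for u v
    proof -
      obtain t K where tK: "(t, K) \<in> p" "u = Inf K" "v = Sup K"
        using uv q(2) unfolding ends_def by auto
      have "{u<..<v} \<subseteq> {Inf K..Sup K}" using tK(2,3) by auto
      also have "\<dots> = K" using K[OF tK(1)] by simp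
      also have "\<dots> \<subseteq> U" using pU tK(1) by blast
      finally show ?thesis .
    qed
    define I :: "real \<times> real \<Rightarrow> real set" where "I = (\<lambda>(u, v). {u<..<v})"
    have fm: "I m \<in> lmeasurable" for m unfolding I_def by (cases m) (simp flip: box_real)
    have IU: "(\<Union>m\<in>ends ` q. I m) \<subseteq> U"
    proof (rule UN_least)
      fix m assume "m \<in> ends ` q"
      then show "I m \<subseteq> U" using subU[of "fst m" "snd m"] by (simp add: I_def split_beta)
    qed
    have "(\<Sum>(u, v)\<in>ends ` q. v - u) = (\<Sum>m\<in>ends ` q. measure lebesgue (I m))"
      using sub by (intro sum.cong) (auto simp: I_def)
    also have "\<dots> = measure lebesgue (\<Union>m\<in>ends ` q. I m)"
    proof (rule measure_finite_Union[symmetric])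
      show "finite (ends ` q)" using q(1) by simp
      show "I ` ends ` q \<subseteq> sets lebesgue" using fm by (simp add: fmeasurableD image_subset_iff)
      show "disjoint_family_on I (ends ` q)" using dis unfolding I_def .
    qed (metis fm fmeasurableD2 infinity_ennreal_def)
    also have "\<dots> \<le> measure lebesgue U"
      by (rule measure_mono_fmeasurable[OF IU _ U(3)])
        (intro sets.finite_UN finite_imageI q(1) fmeasurableD fm)
    also have "\<dots> < d" by (fact U(4))
    finally have "(\<Sum>(u, v)\<in>ends ` q. dist (g u) (g v)) < \<epsilon>"
      using d(2)[OF _ sub dis] q(1) by simp
    also have "(\<Sum>(u, v)\<in>ends ` q. dist (g u) (g v)) = (\<Sum>(t, K)\<in>q. norm (g (Sup K) - g (Inf K)))"
      by (subst sum.reindex[OF inj]) (simp add: ends_def split_beta dist_norm norm_minus_commute)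
    also have "\<dots> = (\<Sum>(t, K)\<in>p. norm (g (Sup K) - g (Inf K)))"
    proof (rule sum.mono_neutral_left[OF tpd(1) q(2)], clarify)
      fix t K assume "(t, K) \<in> p" "(t, K) \<notin> q"
      then have "Inf K = Sup K" using K[of t K] unfolding q_def by auto
      then show "norm (g (Sup K) - g (Inf K)) = 0" by simp
    qed
    finally show ?thesis .
  qed
  with U show ?thesis by blast
qed

text \<open>
  In the Henstock--Kurzweil definition a gauge can treat each tag on its own terms, and the Riemann sums
  then approximate the telescoping sum of the increments of \<open>g\<close>. At a tag outside \<open>S\<close> the gauge is
  so small that \<open>g'\<close> approximates the increment of \<open>g\<close> up to \<open>k\<close> times the length of the
  interval; at a tag in \<open>S\<close> it confines the interval to the open set of the previous lemma, where all
  increments together are small. Replacing \<open>g'\<close> by \<open>0\<close> on \<open>S\<close> does not change the integral.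
\<close>
theorem fundamental_theorem_of_calculus_absolutely_continuous:
  fixes g :: "real \<Rightarrow> 'a::banach"
  assumes "a \<le> b" and ac: "absolutely_continuous_on {a..b} g" and S: "negligible S"
    and deriv: "\<And>t. t \<in> {a..b} - S \<Longrightarrow> (g has_vector_derivative g' t) (at t within {a..b})"
  shows "(g' has_integral (g b - g a)) {a..b}"
proof -
  define h where "h t = (if t \<in> S then 0 else g' t)" for t
  have "(h has_integral (g b - g a)) {a..b}"
    unfolding has_integral_real
  proof (intro allI impI)
    fix e :: real assume "e > 0"
    then have e2: "e / 2 > 0" by simp
    obtain U where U: "open U" "S \<subseteq> U"
      "\<And>p. p tagged_partial_division_of {a..b} \<Longrightarrow> \<forall>(t, K)\<in>p. K \<subseteq> U \<Longrightarrow>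
        (\<Sum>(t, K)\<in>p. norm (g (Sup K) - g (Inf K))) < e / 2"
      using absolutely_continuous_on_small_on_null_tags[OF ac S e2] by blast
    \<comment> \<open>The summand \<open>1\<close> avoids a division by zero when \<open>a = b\<close>.\<close>
    define k where "k = e / (2 * (b - a + 1))"
    have k: "k > 0" "k * (b - a) \<le> e / 2"
      using \<open>e > 0\<close> \<open>a \<le> b\<close> unfolding k_def by (auto simp: field_simps)
    have "\<exists>r>0. \<forall>s\<in>{a..b}. \<bar>s - t\<bar> < r \<longrightarrow> norm (g s - g t - (s - t) *\<^sub>R g' t) \<le> k * \<bar>s - t\<bar>"
      if "t \<in> {a..b} - S" for t
      using deriv[OF that] k(1)
      unfolding has_vector_derivative_def has_derivative_within_alt by (simp add: real_norm_def)
    then obtain r where r: "\<And>t. t \<in> {a..b} - S \<Longrightarrow> r t > 0"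
      "\<And>t s. t \<in> {a..b} - S \<Longrightarrow> s \<in> {a..b} \<Longrightarrow> \<bar>s - t\<bar> < r t \<Longrightarrow>
        norm (g s - g t - (s - t) *\<^sub>R g' t) \<le> k * \<bar>s - t\<bar>"
      by metis
    define G where "G t = (if t \<in> S then U else if t \<in> {a..b} then ball t (r t) else UNIV)" for t
    have "gauge G" using U r(1) unfolding gauge_def G_def by auto
    moreover have "norm ((\<Sum>(t, K)\<in>p. measure lborel K *\<^sub>R h t) - (g b - g a)) < e"
      if p: "p tagged_division_of {a..b}" and fine: "G fine p" for p
    proof -
      note tpd = tagged_division_ofD[OF p]
      let ?D = "\<lambda>(t, K). measure lborel K *\<^sub>R h t - (g (Sup K) - g (Inf K))"
      have GK: "K \<subseteq> G t" if "(t, K) \<in> p" for t K using fine that unfolding fine_def by blast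
      define p1 where "p1 = {(t, K) \<in> p. t \<in> S}"
      define p2 where "p2 = {(t, K) \<in> p. t \<notin> S}"
      have sub: "p1 \<subseteq> p" "p2 \<subseteq> p" "p1 \<inter> p2 = {}" "p = p1 \<union> p2"
        unfolding p1_def p2_def by auto
      have fin: "finite p1" "finite p2" using sub tpd(1) finite_subset by blast+
      have "norm (sum ?D p1) \<le> (\<Sum>(t, K)\<in>p1. norm (g (Sup K) - g (Inf K)))"
        unfolding p1_def h_def by (intro sum_norm_le) (auto simp: norm_minus_commute)
      also have "\<dots> < e / 2"
      proof (rule U(3))
        show "p1 tagged_partial_division_of {a..b}"
          using tagged_partial_division_subset[OF _ sub(1)] p tagged_division_of_def by blast
        show "\<forall>(t, K)\<in>p1. K \<subseteq> U"
          using GK unfolding p1_def G_def by fastforce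
      qed
      finally have D1: "norm (sum ?D p1) < e / 2" .
      have "norm (?D (t, K)) \<le> k * measure lborel K" if tK: "(t, K) \<in> p2" for t K
      proof -
        have tKp: "(t, K) \<in> p" "t \<notin> S" using tK unfolding p2_def by auto
        obtain u v where uv: "K = {u..v}" using tpd(4)[OF tKp(1)] by (auto simp: cbox_interval)
        have tuv: "u \<le> t" "t \<le> v" using tpd(2)[OF tKp(1)] uv by auto
        have tab: "t \<in> {a..b} - S" "u \<in> {a..b}" "v \<in> {a..b}"
          using tpd(3)[OF tKp(1)] uv tuv tKp(2) by auto
        have "K \<subseteq> ball t (r t)" using GK[OF tKp(1)] tab(1) unfolding G_def by simp
        moreover have "u \<in> K" "v \<in> K" using uv tuv by auto
        ultimately have "dist t u < r t" "dist t v < r t" by auto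
        then have near: "\<bar>u - t\<bar> < r t" "\<bar>v - t\<bar> < r t"
          by (auto simp: dist_real_def abs_minus_commute)
        have "?D (t, K) = (g u - g t - (u - t) *\<^sub>R g' t) - (g v - g t - (v - t) *\<^sub>R g' t)"
          using uv tuv tKp(2) by (simp add: h_def algebra_simps)
        also have "norm \<dots> \<le> k * \<bar>u - t\<bar> + k * \<bar>v - t\<bar>"
          using r(2)[OF tab(1,2) near(1)] r(2)[OF tab(1,3) near(2)] norm_triangle_ineq4 by smt
        also have "\<dots> = k * measure lborel K" using uv tuv by (simp add: algebra_simps)
        finally show ?thesis .
      qed
      then have "norm (sum ?D p2) \<le> (\<Sum>(t, K)\<in>p2. k * measure lborel K)"
        by (intro sum_norm_le) auto
      also have "\<dots> \<le> (\<Sum>(t, K)\<in>p. k * measure lborel K)"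
        using tpd(1) sub(2) k(1) by (intro sum_mono2) (auto simp: split_beta)
      also have "\<dots> = k * (\<Sum>(t, K)\<in>p. measure lborel K)"
        by (simp add: sum_distrib_left split_beta)
      also have "\<dots> = k * (b - a)"
        using additive_content_tagged_division[of p a b] p \<open>a \<le> b\<close> by (simp add: cbox_interval)
      finally have D2: "norm (sum ?D p2) \<le> e / 2" using k(2) by simp
      have "(\<Sum>(t, K)\<in>p. measure lborel K *\<^sub>R h t) - (g b - g a) = sum ?D p"
        using additive_tagged_division_1[OF \<open>a \<le> b\<close> p, of g]
        by (simp add: split_beta sum_subtractf)
      also have "\<dots> = sum ?D p1 + sum ?D p2"
        unfolding sub(4) using fin sub(3) by (rule sum.union_disjoint)
      finally show ?thesis using D1 D2 norm_triangle_ineq[of "sum ?D p1" "sum ?D p2"] by simp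
    qed
    ultimately show "\<exists>G. gauge G \<and> (\<forall>p. p tagged_division_of {a..b} \<and> G fine p \<longrightarrow>
        norm ((\<Sum>(t, K)\<in>p. measure lborel K *\<^sub>R h t) - (g b - g a)) < e)"
      by (intro exI[of _ G]) simp
  qed
  then show ?thesis
    by (rule has_integral_spike[OF S, of "{a..b}" g' h, rotated]) (simp add: h_def)
qed

text \<open>
  The form in which the fundamental theorem is used for differential inequalities: the derivative enters
  only through a bound on its norm, and the fundamental theorem supplies its integrability.
\<close>
lemma absolutely_continuous_on_norm_diff_le_integral:
  fixes g :: "real \<Rightarrow> 'a::banach"
  assumes "a \<le> b" and ac: "absolutely_continuous_on {a..b} g" and h: "h integrable_on {a..b}"
    and deriv: "AE t in lebesgue. t \<in> {a..b} \<longrightarrow>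
      (\<exists>v. (g has_vector_derivative v) (at t) \<and> norm v \<le> h t)"
  shows "norm (g b - g a) \<le> integral {a..b} h"
proof -
  obtain S where S: "S \<in> null_sets lebesgue"
    "\<And>t. t \<in> {a..b} - S \<Longrightarrow> \<exists>v. (g has_vector_derivative v) (at t) \<and> norm v \<le> h t"
    using deriv unfolding eventually_ae_filter by fastforce
  then have neg: "negligible S" using negligible_iff_null_sets by blast
  obtain g' where g': "\<And>t. t \<in> {a..b} - S \<Longrightarrow> (g has_vector_derivative g' t) (at t)"
    "\<And>t. t \<in> {a..b} - S \<Longrightarrow> norm (g' t) \<le> h t"
    using S(2) by metis
  define g'' where "g'' t = (if t \<in> S then 0 else g' t)" for t
  define h' where "h' t = (if t \<in> S then 0 else h t)" for t
  have "(g'' has_integral (g b - g a)) {a..b}"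
    using assms(1) ac neg
    by (rule fundamental_theorem_of_calculus_absolutely_continuous)
      (simp add: g''_def g'(1) has_vector_derivative_at_within)
  moreover have "h' integrable_on {a..b}"
    using h by (rule integrable_spike[OF _ neg]) (simp add: h'_def)
  moreover have "norm (g'' t) \<le> h' t" if "t \<in> {a..b}" for t
    using g'(2) that by (simp add: g''_def h'_def)
  ultimately have "norm (g b - g a) \<le> integral {a..b} h'"
    using integral_norm_bound_integral by (metis has_integral_integrable integral_unique)
  also have "\<dots> = integral {a..b} h"
    using neg by (rule integral_spike) (simp add: h'_def)
  finally show ?thesis .
qed

section \<open>A Gronwall estimate with memory\<close>

text \<open>
  The derivative is controlled by the whole past of \<open>w\<close>, through its running supremum. Instead of
  iterating an integral inequality, one measures \<open>w\<close> in the weighted norm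
  \<open>M = max\<^sub>s exp (- K (s - a)) |w s|\<close>, attained at \<open>c\<close>. The running supremum at time \<open>s\<close> is at most
  \<open>M exp (K (s - a))\<close>, because the weight is monotone; integration up to \<open>c\<close> contributes a factor
  \<open>1 / K\<close>, whence \<open>M \<le> G + (L / K) M\<close>. With \<open>K > 2 L\<close> this gives \<open>M \<le> 2 G\<close>.
\<close>
lemma delay_gronwall:
  fixes w :: "real \<Rightarrow> 'a::banach"
  assumes "a \<le> b" and ac: "absolutely_continuous_on {a..b} w" and w0: "w a = 0"
    and h: "h integrable_on {a..b}" "\<And>t. t \<in> {a..b} \<Longrightarrow> 0 \<le> h t" "integral {a..b} h \<le> G"
    and "L \<ge> 0"
    and deriv: "AE t in lebesgue. t \<in> {a..b} \<longrightarrow>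
      (\<exists>v. (w has_vector_derivative v) (at t) \<and> norm v \<le> h t + L * (SUP s\<in>{a..t}. norm (w s)))"
    and t: "t \<in> {a..b}"
  shows "norm (w t) \<le> 2 * G * exp ((2 * L + 1) * (b - a))"
proof -
  \<comment> \<open>At least twice \<open>L\<close>, to absorb \<open>M\<close>, and positive also for \<open>L = 0\<close>.\<close>
  define K where "K = 2 * L + 1"
  have K: "K > 0" "L / K \<le> 1 / 2" using \<open>L \<ge> 0\<close> unfolding K_def by (auto simp: field_simps)
  have G: "G \<ge> 0"
    using h integral_nonneg[OF h(1)] by force
  have cont: "continuous_on {a..b} w"
    using ac by (rule absolutely_continuous_on_imp_continuous_on)
  define p where "p s = exp (K * (s - a))" for s
  define q where "q s = exp (- K * (s - a))" for s
  have pq: "p s * q s = 1" for s unfolding p_def q_def by (simp flip: exp_add)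
  have pq_pos: "p s > 0" "q s > 0" for s unfolding p_def q_def by auto
  have p_mono: "p s \<le> p s'" if "s \<le> s'" for s s'
    using that K(1) unfolding p_def by simp
  have q_cont: "continuous_on {a..b} q"
    unfolding q_def by (intro continuous_intros)
  let ?m = "\<lambda>s. q s * norm (w s)"
  have "\<exists>c\<in>{a..b}. \<forall>s\<in>{a..b}. ?m s \<le> ?m c"
    using \<open>a \<le> b\<close> cont q_cont by (intro continuous_attains_sup continuous_intros) auto
  then obtain c where c: "c \<in> {a..b}" "\<And>s. s \<in> {a..b} \<Longrightarrow> ?m s \<le> ?m c" by blast
  define M where "M = ?m c"
  have M: "M \<ge> 0" unfolding M_def using pq_pos(2)[of c] by simp
  have wM: "norm (w s) \<le> M * p s" if "s \<in> {a..b}" for s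
  proof -
    have "norm (w s) = ?m s * p s" using pq[of s] by (simp add: mult.commute mult.left_commute)
    also have "\<dots> \<le> M * p s"
      using c(2)[OF that] pq_pos(1)[of s] unfolding M_def by (intro mult_right_mono) auto
    finally show ?thesis .
  qed
  have sup: "(SUP s\<in>{a..t}. norm (w s)) \<le> M * p t" if "t \<in> {a..b}" for t
  proof (rule cSUP_least)
    show "{a..t} \<noteq> {}" using that by simp
    fix s assume s: "s \<in> {a..t}"
    then have "norm (w s) \<le> M * p s" using wM that by simp
    also have "\<dots> \<le> M * p t" using s M p_mono by (intro mult_left_mono) auto
    finally show "norm (w s) \<le> M * p t" .
  qed
  let ?E = "\<lambda>s. L * M / K * p s"
  have E: "((\<lambda>s. L * M * p s) has_integral (?E c - ?E a)) {a..c}"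
    unfolding p_def using c(1) K(1)
    by (intro fundamental_theorem_of_calculus)
      (auto intro!: derivative_eq_intros simp flip: has_real_derivative_iff_has_vector_derivative)
  have E_nonneg: "?E a \<ge> 0" using \<open>L \<ge> 0\<close> M K(1) pq_pos(1)[of a] by simp
  have hc: "h integrable_on {a..c}"
    using h(1) c(1) by (intro integrable_on_subinterval[OF h(1)]) auto
  have acc: "absolutely_continuous_on {a..c} w"
    using ac c(1) by (elim absolutely_continuous_on_subset) auto
  have "norm (w c - w a) \<le> integral {a..c} (\<lambda>s. h s + L * M * p s)"
  proof (rule absolutely_continuous_on_norm_diff_le_integral[OF _ acc])
    show "a \<le> c" using c(1) by simp
    show "(\<lambda>s. h s + L * M * p s) integrable_on {a..c}"
      using hc E by (intro integrable_add) auto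
    show "AE t in lebesgue. t \<in> {a..c} \<longrightarrow> (\<exists>v. (w has_vector_derivative v) (at t) \<and>
        norm v \<le> h t + L * M * p t)"
      using deriv
    proof eventually_elim
      case (elim t)
      show ?case
      proof
        assume "t \<in> {a..c}"
        then have t: "t \<in> {a..b}" using c(1) by auto
        then obtain v where v: "(w has_vector_derivative v) (at t)"
          "norm v \<le> h t + L * (SUP s\<in>{a..t}. norm (w s))" using elim by blast
        have "L * (SUP s\<in>{a..t}. norm (w s)) \<le> L * (M * p t)"
          using sup[OF t] \<open>L \<ge> 0\<close> by (rule mult_left_mono)
        then show "\<exists>v. (w has_vector_derivative v) (at t) \<and>
            norm v \<le> h t + L * M * p t"
          using v by (intro exI[of _ v]) (simp add: mult.assoc)
      qed
    qed
  qed
  also have "\<dots> = integral {a..c} h + (?E c - ?E a)"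
    by (simp only: integral_add[OF hc has_integral_integrable[OF E]] integral_unique[OF E])
  also have "integral {a..c} h \<le> integral {a..b} h"
    using hc h c(1) by (intro integral_subset_le) auto
  finally have wc: "norm (w c) \<le> G + ?E c"
    using h(3) w0 E_nonneg by simp
  have "M = q c * norm (w c)" by (simp add: M_def)
  also have "\<dots> \<le> q c * (G + ?E c)"
    using wc pq_pos(2)[of c] by (intro mult_left_mono) auto
  also have "\<dots> = q c * G + (L / K) * M * (p c * q c)"
    by (simp add: algebra_simps)
  also have "\<dots> = q c * G + (L / K) * M" using pq by simp
  also have "\<dots> \<le> 1 * G + 1 / 2 * M"
    using G M K c(1) by (intro add_mono mult_right_mono) (auto simp: q_def)
  finally have "M \<le> 2 * G" by simp
  have "norm (w t) \<le> M * p t" using wM[OF t] .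
  also have "\<dots> \<le> 2 * G * p b"
    using \<open>M \<le> 2 * G\<close> M t p_mono pq_pos(1)[of t] by (intro mult_mono) auto
  finally show ?thesis unfolding K_def p_def .
qed

section \<open>States and solutions\<close>

lemma norm_le_sup_norm:
  assumes "continuous_on {- \<tau>..0} \<psi>" "s \<in> {- \<tau>..0}"
  shows "norm (\<psi> s) \<le> sup_norm \<tau> \<psi>"
  unfolding sup_norm_def
proof (rule cSUP_upper[OF assms(2)])
  have "compact ((\<lambda>s. norm (\<psi> s)) ` {- \<tau>..0})"
    using assms(1) by (intro compact_continuous_image continuous_intros) auto
  then show "bdd_above ((\<lambda>s. norm (\<psi> s)) ` {- \<tau>..0})"
    by (intro bounded_imp_bdd_above compact_imp_bounded)
qed

lemma sup_norm_nonneg: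
  assumes "\<tau> \<ge> 0" "continuous_on {- \<tau>..0} \<psi>"
  shows "0 \<le> sup_norm \<tau> \<psi>"
proof -
  have "0 \<le> norm (\<psi> 0)" by simp
  also have "\<dots> \<le> sup_norm \<tau> \<psi>" using assms by (intro norm_le_sup_norm) auto
  finally show ?thesis .
qed

lemma sup_dist_nonneg:
  assumes "\<tau> \<ge> 0" "\<psi> \<in> states \<tau>" "\<phi> \<in> states \<tau>"
  shows "0 \<le> sup_dist \<tau> \<psi> \<phi>"
  unfolding sup_dist_def
proof (rule sup_norm_nonneg[OF assms(1)])
  show "continuous_on {- \<tau>..0} (\<lambda>s. \<psi> s - \<phi> s)"
    using assms(2,3) unfolding states_def by (intro continuous_on_diff) blast+
qed

lemma segment_in_states:
  assumes "solution_on \<tau> f t\<^sub>0 \<psi> u e x" "t\<^sub>0 \<le> t" "ereal t < e"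
  shows "segment \<tau> x t \<in> states \<tau>"
proof -
  have "continuous_on {t. t\<^sub>0 - \<tau> \<le> t \<and> ereal t < e} x"
    using assms(1) unfolding solution_on_def by blast
  moreover have "continuous_on {- \<tau>..0} (\<lambda>s. t + s)" by (intro continuous_intros)
  moreover have "(\<lambda>s. t + s) ` {- \<tau>..0} \<subseteq> {t. t\<^sub>0 - \<tau> \<le> t \<and> ereal t < e}"
    using assms(2,3) by (auto intro: le_less_trans[of _ "ereal t"])
  ultimately have "continuous_on {- \<tau>..0} (\<lambda>s. x (t + s))"
    by (rule continuous_on_compose2)
  then have "continuous_on {- \<tau>..0} (segment \<tau> x t)"
    by (rule continuous_on_eq) (simp add: segment_def)
  then show ?thesis
    unfolding states_def by (simp add: segment_def)
qed

lemma solution_before_initial_time: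
  assumes "solution_on \<tau> f t\<^sub>0 \<psi> u e x" "t\<^sub>0 - \<tau> \<le> t" "t \<le> t\<^sub>0"
  shows "x t = \<psi> (t - t\<^sub>0)"
proof -
  have "segment \<tau> x t\<^sub>0 (t - t\<^sub>0) = \<psi> (t - t\<^sub>0)"
    using assms(1) unfolding solution_on_def by simp
  then show ?thesis using assms(2,3) by (simp add: segment_def)
qed

text \<open>
  The distance of two states looks back by \<open>\<tau>\<close>, possibly beyond the initial time; there the two
  trajectories coincide, so only their distance from the initial time on matters.
\<close>
lemma sup_dist_segment_le:
  assumes "\<tau> \<ge> 0"
    and eq: "\<And>s. t\<^sub>0 - \<tau> \<le> s \<Longrightarrow> s \<le> t\<^sub>0 \<Longrightarrow> y s = x s"
    and bound: "\<And>s. t\<^sub>0 \<le> s \<Longrightarrow> s \<le> t \<Longrightarrow> norm (y s - x s) \<le> D"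
    and "t\<^sub>0 \<le> t"
  shows "sup_dist \<tau> (segment \<tau> y t) (segment \<tau> x t) \<le> D"
  unfolding sup_dist_def sup_norm_def
proof (rule cSUP_least)
  show "{- \<tau>..0} \<noteq> {}" using \<open>\<tau> \<ge> 0\<close> by simp
  fix s assume s: "s \<in> {- \<tau>..0}"
  have "D \<ge> 0" using bound[of t\<^sub>0] \<open>t\<^sub>0 \<le> t\<close> by (meson norm_ge_zero order.refl order.trans)
  then have "norm (y (t + s) - x (t + s)) \<le> D"
    using s eq[of "t + s"] bound[of "t + s"] \<open>t\<^sub>0 \<le> t\<close> by (cases "t + s \<le> t\<^sub>0") auto
  then show "norm (segment \<tau> y t s - segment \<tau> x t s) \<le> D"
    using s by (simp add: segment_def)
qed

section \<open>The effect of the input\<close>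

text \<open>
  Small values of the input are covered by uniform continuity at zero input, and cost \<open>\<eta>\<close>. For
  values of norm above the threshold \<open>d\<close>, the growth bound is affine in \<open>\<gamma> (norm \<mu>)\<close>, and there
  \<open>1 \<le> \<gamma> (norm \<mu>) / \<gamma> d\<close> turns the constant term into a multiple of \<open>\<gamma> (norm \<mu>)\<close>. This is what
  makes the integral of \<open>\<gamma> (norm u)\<close> the right measure of the size of an input.
\<close>
lemma input_perturbation_bound:
  fixes f :: "real \<Rightarrow> (real \<Rightarrow> 'a::real_normed_vector) \<Rightarrow> 'b::real_normed_vector \<Rightarrow> 'a"
  assumes "\<tau> \<ge> 0" and R1: "class_K_inf \<gamma>" "mono_on {0..} N" "\<And>s. s \<ge> 0 \<Longrightarrow> N s > 0"
      "\<And>t \<psi> \<mu>. t \<ge> 0 \<Longrightarrow> \<psi> \<in> states \<tau> \<Longrightarrow>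
        norm (f t \<psi> \<mu>) \<le> N (sup_norm \<tau> \<psi>) * (1 + \<gamma> (norm \<mu>))"
    and R2: "\<And>r \<epsilon>. r > 0 \<Longrightarrow> \<epsilon> > 0 \<Longrightarrow>
      \<exists>\<delta>>0. \<forall>t\<ge>0. \<forall>\<psi>\<in>states \<tau>. \<forall>\<mu>. sup_norm \<tau> \<psi> \<le> r \<and> norm \<mu> \<le> \<delta> \<longrightarrow>
        norm (f t \<psi> \<mu> - f t \<psi> 0) < \<epsilon>"
    and "r > 0" "\<eta> > 0"
  shows "\<exists>C>0. \<forall>t\<ge>0. \<forall>\<psi>\<in>states \<tau>. \<forall>\<mu>. sup_norm \<tau> \<psi> \<le> r \<longrightarrow>
    norm (f t \<psi> \<mu> - f t \<psi> 0) \<le> \<eta> + C * \<gamma> (norm \<mu>)"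
proof -
  obtain d where d: "d > 0"
    "\<And>t \<psi> \<mu>. t \<ge> 0 \<Longrightarrow> \<psi> \<in> states \<tau> \<Longrightarrow> sup_norm \<tau> \<psi> \<le> r \<Longrightarrow> norm \<mu> \<le> d \<Longrightarrow>
      norm (f t \<psi> \<mu> - f t \<psi> 0) < \<eta>"
    using R2[OF \<open>r > 0\<close> \<open>\<eta> > 0\<close>] by blast
  have \<gamma>: "\<gamma> 0 = 0" "\<And>p q. 0 \<le> p \<Longrightarrow> p < q \<Longrightarrow> \<gamma> p < \<gamma> q"
    using R1(1) unfolding class_K_inf_def by (auto simp: strict_mono_on_def)
  have \<gamma>d: "\<gamma> d > 0" using \<gamma>(2)[of 0 d] d(1) \<gamma>(1) by simp
  have \<gamma>nonneg: "\<gamma> (norm \<mu>) \<ge> 0" for \<mu> :: 'b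
    using R1(1) unfolding class_K_inf_def by (auto simp: Pi_iff)
  define C where "C = N r * (2 / \<gamma> d + 1)"
  have "C > 0" unfolding C_def using R1(3)[of r] \<open>r > 0\<close> \<gamma>d by (simp add: add_pos_pos)
  moreover have "norm (f t \<psi> \<mu> - f t \<psi> 0) \<le> \<eta> + C * \<gamma> (norm \<mu>)"
    if t: "t \<ge> 0" "\<psi> \<in> states \<tau>" "sup_norm \<tau> \<psi> \<le> r" for t \<psi> \<mu>
  proof (cases "norm \<mu> \<le> d")
    case True
    then have "norm (f t \<psi> \<mu> - f t \<psi> 0) < \<eta>" using d(2) t by blast
    moreover have "0 \<le> C * \<gamma> (norm \<mu>)" using \<open>C > 0\<close> \<gamma>nonneg by simp
    ultimately show ?thesis by simp
  next
    case False
    then have big: "\<gamma> d \<le> \<gamma> (norm \<mu>)" using \<gamma>(2)[of d "norm \<mu>"] d(1) by simp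
    have "0 \<le> sup_norm \<tau> \<psi>"
      using t(2) \<open>\<tau> \<ge> 0\<close> by (intro sup_norm_nonneg) (auto simp: states_def)
    then have N: "N (sup_norm \<tau> \<psi>) \<le> N r"
      using R1(2) t(3) \<open>r > 0\<close> by (auto simp: mono_on_def)
    have fN: "norm (f t \<psi> \<nu>) \<le> N r * (1 + \<gamma> (norm \<nu>))" for \<nu>
      using \<gamma>nonneg[of \<nu>] by (intro order.trans[OF R1(4)[OF t(1,2)]] mult_right_mono[OF N]) simp
    have "norm (f t \<psi> \<mu> - f t \<psi> 0) \<le> norm (f t \<psi> \<mu>) + norm (f t \<psi> 0)"
      by (rule norm_triangle_ineq4)
    also have "\<dots> \<le> N r * (1 + \<gamma> (norm \<mu>)) + N r * (1 + 0)"
      using fN[of \<mu>] fN[of 0] \<gamma>(1) by simp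
    also have "\<dots> = N r * (2 * 1 + \<gamma> (norm \<mu>))" by (simp add: algebra_simps)
    also have "\<dots> \<le> N r * (2 * (\<gamma> (norm \<mu>) / \<gamma> d) + \<gamma> (norm \<mu>))"
      using big \<gamma>d R1(3)[of r] \<open>r > 0\<close> by (intro mult_left_mono add_mono) auto
    also have "\<dots> = C * \<gamma> (norm \<mu>)" unfolding C_def by (simp add: algebra_simps)
    finally show ?thesis using \<open>\<eta> > 0\<close> by simp
  qed
  ultimately show ?thesis by blast
qed

text \<open>
  Transfers the extended nonnegative Lebesgue integral in \<open>gamma_norm\<close> to the Henstock--Kurzweil
  integral over a bounded interval.
\<close>
lemma gamma_input_integral_le:
  fixes u :: "real \<Rightarrow> 'b::euclidean_space"
  assumes "class_K_inf \<gamma>" and u: "u \<in> inputs" and le: "gamma_norm \<gamma> u \<le> ennreal \<delta>"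
    and "\<delta> \<ge> 0" "a \<ge> 0"
  shows "(\<lambda>s. \<gamma> (norm (u s))) integrable_on {a..b}" (is ?I)
    and "integral {a..b} (\<lambda>s. \<gamma> (norm (u s))) \<le> \<delta>" (is ?L)
proof -
  let ?g = "\<lambda>s. \<gamma> (norm (u s))" and ?M = "lebesgue_on {0..}"
  have nonneg: "?g s \<ge> 0" for s
    using assms(1) unfolding class_K_inf_def by (auto simp: Pi_iff)
  have "continuous_on UNIV (\<lambda>\<mu>. \<gamma> (norm (\<mu> :: 'b)))"
  proof (rule continuous_on_compose2[of "{0..}" \<gamma> UNIV norm])
    show "continuous_on {0..} \<gamma>" using assms(1) unfolding class_K_inf_def by blast
    show "continuous_on UNIV (norm :: 'b \<Rightarrow> real)" by (intro continuous_intros)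
  qed auto
  then have "(\<lambda>\<mu>. \<gamma> (norm (\<mu> :: 'b))) \<in> borel_measurable borel"
    by (rule borel_measurable_continuous_onI)
  moreover have "u \<in> borel_measurable ?M" using u unfolding inputs_def by blast
  ultimately have meas: "?g \<in> borel_measurable ?M"
    by (rule measurable_compose[rotated])
  have "(\<integral>\<^sup>+s. ennreal (?g s) \<partial>?M) = gamma_norm \<gamma> u"
    unfolding gamma_norm_def by (simp add: nn_integral_restrict_space)
  then have nn: "(\<integral>\<^sup>+s. ennreal (?g s) \<partial>?M) \<le> ennreal \<delta>" using le by simp
  then have int: "integrable ?M ?g"
    using meas nonneg by (intro integrableI_nonneg) (auto intro: le_less_trans)
  have "integral\<^sup>L ?M ?g = enn2real (\<integral>\<^sup>+s. ennreal (?g s) \<partial>?M)"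
    using meas nonneg by (intro integral_eq_nn_integral) auto
  also have "\<dots> \<le> \<delta>" using nn \<open>\<delta> \<ge> 0\<close> by (rule enn2real_leI[rotated])
  finally have int0: "?g integrable_on {0..}" "integral {0..} ?g \<le> \<delta>"
    using integrable_on_lebesgue_on[OF int] lebesgue_integral_eq_integral[OF int] by auto
  have sub: "{a..b} \<subseteq> {0..}" using \<open>a \<ge> 0\<close> by auto
  show ?I by (rule integrable_on_subinterval[OF int0(1) sub])
  then have "integral {a..b} ?g \<le> integral {0..} ?g"
    using nonneg by (intro integral_subset_le[OF sub _ int0(1)]) auto
  then show ?L using int0(2) by simp
qed



section \<open>Continuous dependence on the input\<close>

theorem lemma4p2:
  fixes \<tau> :: real
    and f :: "real \<Rightarrow> (real \<Rightarrow> real ^ 'n) \<Rightarrow> real ^ 'm \<Rightarrow> real ^ 'n"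
    and \<gamma> N :: "real \<Rightarrow> real"
  assumes delay: "\<tau> \<ge> 0"
    and cont: "\<And>t. t \<ge> 0 \<Longrightarrow> continuous_in_state_and_input \<tau> (f t)"
    and meas: "\<And>\<psi> \<mu>. \<psi> \<in> states \<tau> \<Longrightarrow> (\<lambda>t. f t \<psi> \<mu>) \<in> borel_measurable (lebesgue_on {0..})"
    and solutions: "\<And>t\<^sub>0 \<psi> u. t\<^sub>0 \<ge> 0 \<Longrightarrow> \<psi> \<in> states \<tau> \<Longrightarrow> u \<in> inputs \<Longrightarrow>
      \<exists>!p. maximal_solution \<tau> f t\<^sub>0 \<psi> u (fst p) (snd p)"
    and R1: "class_K_inf \<gamma>" "mono_on {0..} N" "\<And>s. s \<ge> 0 \<Longrightarrow> N s > 0"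
      "\<And>t \<psi> \<mu>. t \<ge> 0 \<Longrightarrow> \<psi> \<in> states \<tau> \<Longrightarrow>
        norm (f t \<psi> \<mu>) \<le> N (sup_norm \<tau> \<psi>) * (1 + \<gamma> (norm \<mu>))"
    and R2: "\<And>r \<epsilon>. r > 0 \<Longrightarrow> \<epsilon> > 0 \<Longrightarrow>
      \<exists>\<delta>>0. \<forall>t\<ge>0. \<forall>\<psi>\<in>states \<tau>. \<forall>\<mu>. sup_norm \<tau> \<psi> \<le> r \<and> norm \<mu> \<le> \<delta> \<longrightarrow>
        norm (f t \<psi> \<mu> - f t \<psi> 0) < \<epsilon>"
    and R3: "\<And>r. r > 0 \<Longrightarrow>
      \<exists>L. \<forall>t\<ge>0. \<forall>\<psi>\<in>states \<tau>. \<forall>\<phi>\<in>states \<tau>. sup_norm \<tau> \<psi> \<le> r \<and> sup_norm \<tau> \<phi> \<le> r \<longrightarrow>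
        norm (f t \<psi> 0 - f t \<phi> 0) \<le> L * sup_dist \<tau> \<psi> \<phi>"
  shows "\<forall>r>0. \<forall>\<epsilon>>0. \<forall>T>0. \<exists>\<delta>>0. \<forall>t\<^sub>0\<ge>0. \<forall>\<psi>\<in>states \<tau>. \<forall>u\<in>inputs.
    gamma_norm \<gamma> u \<le> ennreal \<delta> \<longrightarrow>
    (\<forall>e\<^sub>x x e\<^sub>z z.
      maximal_solution \<tau> f t\<^sub>0 \<psi> u e\<^sub>x x \<and> maximal_solution \<tau> f t\<^sub>0 \<psi> (\<lambda>_. 0) e\<^sub>z z \<longrightarrow>
      (\<forall>t'\<in>{t\<^sub>0..t\<^sub>0 + T}.
        ereal t' < e\<^sub>x \<and> ereal t' < e\<^sub>z \<and>
        (\<forall>t\<in>{t\<^sub>0..t'}. sup_norm \<tau> (segment \<tau> x t) \<le> r \<and> sup_norm \<tau> (segment \<tau> z t) \<le> r) \<longrightarrow>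
        (\<forall>t\<in>{t\<^sub>0..t'}. sup_dist \<tau> (segment \<tau> z t) (segment \<tau> x t) \<le> \<epsilon>)))"
proof (intro allI impI)
  fix r \<epsilon> T :: real assume r: "r > 0" and "\<epsilon> > 0" "T > 0"
  obtain L0 where L0: "\<And>t \<psi> \<phi>. t \<ge> 0 \<Longrightarrow> \<psi> \<in> states \<tau> \<Longrightarrow> \<phi> \<in> states \<tau> \<Longrightarrow>
      sup_norm \<tau> \<psi> \<le> r \<Longrightarrow> sup_norm \<tau> \<phi> \<le> r \<Longrightarrow>
      norm (f t \<psi> 0 - f t \<phi> 0) \<le> L0 * sup_dist \<tau> \<psi> \<phi>"
    using R3[OF r] by blast
  define L where "L = max L0 0"
  have L: "L \<ge> 0" "L0 \<le> L" unfolding L_def by auto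
  \<comment> \<open>\<open>A\<close> is the factor of the Gronwall estimate over a time span \<open>T\<close>. The total perturbation is at
    most \<open>\<eta> * T + C * \<delta>\<close>, and \<open>A\<close> times each of the two terms is allotted \<open>\<epsilon> / 2\<close>. The constant
    \<open>C\<close> depends on \<open>\<eta>\<close>, so \<open>\<eta>\<close> is fixed before \<open>\<delta>\<close>.\<close>
  define A where "A = 2 * exp ((2 * L + 1) * T)"
  define \<eta> where "\<eta> = \<epsilon> / (2 * A * T)"
  have "A > 0" unfolding A_def by simp
  have "\<eta> > 0" unfolding \<eta>_def using \<open>\<epsilon> > 0\<close> \<open>T > 0\<close> \<open>A > 0\<close> by simp
  obtain C where "C > 0" and C: "\<And>t \<psi> \<mu>. t \<ge> 0 \<Longrightarrow> \<psi> \<in> states \<tau> \<Longrightarrow> sup_norm \<tau> \<psi> \<le> r \<Longrightarrow>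
      norm (f t \<psi> \<mu> - f t \<psi> 0) \<le> \<eta> + C * \<gamma> (norm \<mu>)"
    using input_perturbation_bound[OF delay R1 R2 r \<open>\<eta> > 0\<close>] by blast
  define \<delta> where "\<delta> = \<epsilon> / (2 * A * C)"
  have "\<delta> > 0" unfolding \<delta>_def using \<open>\<epsilon> > 0\<close> \<open>C > 0\<close> \<open>A > 0\<close> by simp
  have budget: "A * (\<eta> * T + C * \<delta>) = \<epsilon>"
    unfolding \<eta>_def \<delta>_def using \<open>A > 0\<close> \<open>T > 0\<close> \<open>C > 0\<close> by (simp add: field_simps)
  have \<gamma>nonneg: "\<gamma> (norm \<mu>) \<ge> 0" for \<mu> :: "real ^ 'm"
    using R1(1) unfolding class_K_inf_def by (auto simp: Pi_iff)
  have main: "sup_dist \<tau> (segment \<tau> z t) (segment \<tau> x t) \<le> \<epsilon>"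
    if "t\<^sub>0 \<ge> 0" and u: "u \<in> inputs" "gamma_norm \<gamma> u \<le> ennreal \<delta>"
      and x: "solution_on \<tau> f t\<^sub>0 \<psi> u e\<^sub>x x" and z: "solution_on \<tau> f t\<^sub>0 \<psi> (\<lambda>_. 0) e\<^sub>z z"
      and t': "t\<^sub>0 \<le> t'" "t' \<le> t\<^sub>0 + T" "ereal t' < e\<^sub>x" "ereal t' < e\<^sub>z"
      and bd: "\<And>t. t \<in> {t\<^sub>0..t'} \<Longrightarrow>
        sup_norm \<tau> (segment \<tau> x t) \<le> r \<and> sup_norm \<tau> (segment \<tau> z t) \<le> r"
      and t: "t \<in> {t\<^sub>0..t'}"
    for t\<^sub>0 \<psi> u e\<^sub>x x e\<^sub>z z t' t
  proof -
    define w where "w s = z s - x s" for s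
    have w0: "w s = 0" if "t\<^sub>0 - \<tau> \<le> s" "s \<le> t\<^sub>0" for s
      unfolding w_def using solution_before_initial_time[OF x that]
        solution_before_initial_time[OF z that] by simp
    have ac: "absolutely_continuous_on {t\<^sub>0..t'} w"
      unfolding w_def using x z t' unfolding solution_on_def
      by (intro absolutely_continuous_on_diff) blast+
    define h where "h s = \<eta> + C * \<gamma> (norm (u s))" for s
    note \<gamma>u = gamma_input_integral_le[OF R1(1) u less_imp_le[OF \<open>\<delta> > 0\<close>] \<open>t\<^sub>0 \<ge> 0\<close>, of t']
    have hint: "(h has_integral \<eta> * (t' - t\<^sub>0) + C * integral {t\<^sub>0..t'} (\<lambda>s. \<gamma> (norm (u s)))) {t\<^sub>0..t'}"
      unfolding h_def
      using has_integral_add[OF has_integral_const_real[of \<eta> t\<^sub>0 t']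
          has_integral_mult_right[OF integrable_integral[OF \<gamma>u(1)], of C]] t'(1)
      by (simp add: mult.commute)
    have hnonneg: "h s \<ge> 0" for s
      unfolding h_def using \<open>\<eta> > 0\<close> \<open>C > 0\<close> \<gamma>nonneg by (simp add: add_nonneg_nonneg)
    have "\<eta> * (t' - t\<^sub>0) \<le> \<eta> * T" "C * integral {t\<^sub>0..t'} (\<lambda>s. \<gamma> (norm (u s))) \<le> C * \<delta>"
      using \<open>\<eta> > 0\<close> \<open>C > 0\<close> t' \<gamma>u(2) by (auto intro!: mult_left_mono)
    then have hle: "integral {t\<^sub>0..t'} h \<le> \<eta> * T + C * \<delta>"
      unfolding integral_unique[OF hint] by (rule add_mono)
    have dist_sup: "sup_dist \<tau> (segment \<tau> z s) (segment \<tau> x s) \<le> (SUP \<sigma>\<in>{t\<^sub>0..s}. norm (w \<sigma>))"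
      if s: "s \<in> {t\<^sub>0..t'}" for s
    proof (rule sup_dist_segment_le[OF delay])
      have "continuous_on {t\<^sub>0..s} w"
        using absolutely_continuous_on_imp_continuous_on[OF ac] s
        by (elim continuous_on_subset) auto
      then have "bdd_above ((\<lambda>\<sigma>. norm (w \<sigma>)) ` {t\<^sub>0..s})"
        by (intro bounded_imp_bdd_above compact_imp_bounded compact_continuous_image
            continuous_on_norm) auto
      then show "norm (z \<sigma> - x \<sigma>) \<le> (SUP \<sigma>\<in>{t\<^sub>0..s}. norm (w \<sigma>))" if "t\<^sub>0 \<le> \<sigma>" "\<sigma> \<le> s" for \<sigma>
        using that cSUP_upper[of \<sigma> "{t\<^sub>0..s}" "\<lambda>\<sigma>. norm (w \<sigma>)"] by (simp add: w_def)
    qed (use w0 s in \<open>auto simp: w_def\<close>)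
    have AEx: "AE s in lebesgue. t\<^sub>0 \<le> s \<and> ereal s < e\<^sub>x \<longrightarrow>
        (x has_vector_derivative f s (segment \<tau> x s) (u s)) (at s)"
      using x unfolding solution_on_def by blast
    have AEz: "AE s in lebesgue. t\<^sub>0 \<le> s \<and> ereal s < e\<^sub>z \<longrightarrow>
        (z has_vector_derivative f s (segment \<tau> z s) 0) (at s)"
      using z unfolding solution_on_def by blast
    have deriv: "AE s in lebesgue. s \<in> {t\<^sub>0..t'} \<longrightarrow> (\<exists>v. (w has_vector_derivative v) (at s) \<and>
        norm v \<le> h s + L * (SUP \<sigma>\<in>{t\<^sub>0..s}. norm (w \<sigma>)))"
      using AEx AEz
    proof eventually_elim
      case (elim s)
      show ?case
      proof
        assume s: "s \<in> {t\<^sub>0..t'}"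
        then have se: "t\<^sub>0 \<le> s" "ereal s < e\<^sub>x" "ereal s < e\<^sub>z" "s \<ge> 0"
          using t' \<open>t\<^sub>0 \<ge> 0\<close> by (auto intro: le_less_trans[of _ "ereal t'"])
        let ?x = "segment \<tau> x s" and ?z = "segment \<tau> z s"
        have st: "?x \<in> states \<tau>" "?z \<in> states \<tau>"
          using segment_in_states[OF x se(1,2)] segment_in_states[OF z se(1,3)] .
        have v: "(w has_vector_derivative (f s ?z 0 - f s ?x (u s))) (at s)"
          unfolding w_def using elim se by (intro has_vector_derivative_diff) blast+
        \<comment> \<open>The derivative is split at \<open>f s ?x 0\<close>: the Lipschitz bound holds only for zero input,
          and the input is compared with zero along \<open>x\<close>.\<close>
        have "norm (f s ?z 0 - f s ?x 0) \<le> L0 * sup_dist \<tau> ?z ?x"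
          using L0[OF se(4) st(2,1)] bd[OF s] by blast
        also have "\<dots> \<le> L * sup_dist \<tau> ?z ?x"
          using L(2) sup_dist_nonneg[OF delay st(2,1)] by (rule mult_right_mono)
        also have "\<dots> \<le> L * (SUP \<sigma>\<in>{t\<^sub>0..s}. norm (w \<sigma>))"
          using dist_sup[OF s] L(1) by (rule mult_left_mono)
        finally have "norm (f s ?z 0 - f s ?x 0) \<le> L * (SUP \<sigma>\<in>{t\<^sub>0..s}. norm (w \<sigma>))" .
        moreover have "norm (f s ?x (u s) - f s ?x 0) \<le> h s"
          unfolding h_def using C[OF se(4) st(1)] bd[OF s] by blast
        moreover have "norm (f s ?z 0 - f s ?x (u s)) \<le>
            norm (f s ?z 0 - f s ?x 0) + norm (f s ?x (u s) - f s ?x 0)"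
          using norm_triangle_ineq4[of "f s ?z 0 - f s ?x 0" "f s ?x (u s) - f s ?x 0"] by simp
        ultimately show "\<exists>v. (w has_vector_derivative v) (at s) \<and>
            norm v \<le> h s + L * (SUP \<sigma>\<in>{t\<^sub>0..s}. norm (w \<sigma>))"
          using v by (intro exI[of _ "f s ?z 0 - f s ?x (u s)"]) simp
      qed
    qed
    have wle: "norm (w s) \<le> \<epsilon>" if s: "s \<in> {t\<^sub>0..t'}" for s
    proof -
      have "w t\<^sub>0 = 0" using w0 delay by simp
      then have "norm (w s) \<le> 2 * (\<eta> * T + C * \<delta>) * exp ((2 * L + 1) * (t' - t\<^sub>0))"
        by (rule delay_gronwall[OF t'(1) ac _ has_integral_integrable[OF hint] hnonneg hle L(1) deriv s])
      also have "\<dots> \<le> 2 * (\<eta> * T + C * \<delta>) * exp ((2 * L + 1) * T)"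
        using t' L(1) \<open>\<eta> > 0\<close> \<open>T > 0\<close> \<open>C > 0\<close> \<open>\<delta> > 0\<close>
        by (intro mult_left_mono) (auto intro!: mult_left_mono)
      also have "\<dots> = A * (\<eta> * T + C * \<delta>)" unfolding A_def by simp
      also have "\<dots> = \<epsilon>" by (fact budget)
      finally show ?thesis .
    qed
    show ?thesis
    proof (rule sup_dist_segment_le[OF delay])
      show "z s = x s" if "t\<^sub>0 - \<tau> \<le> s" "s \<le> t\<^sub>0" for s using w0[OF that] by (simp add: w_def)
      show "norm (z s - x s) \<le> \<epsilon>" if "t\<^sub>0 \<le> s" "s \<le> t" for s
        using wle[of s] that t by (simp add: w_def)
      show "t\<^sub>0 \<le> t" using t by simp
    qed
  qed
  show "\<exists>\<delta>>0. \<forall>t\<^sub>0\<ge>0. \<forall>\<psi>\<in>states \<tau>. \<forall>u\<in>inputs.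
    gamma_norm \<gamma> u \<le> ennreal \<delta> \<longrightarrow>
    (\<forall>e\<^sub>x x e\<^sub>z z.
      maximal_solution \<tau> f t\<^sub>0 \<psi> u e\<^sub>x x \<and> maximal_solution \<tau> f t\<^sub>0 \<psi> (\<lambda>_. 0) e\<^sub>z z \<longrightarrow>
      (\<forall>t'\<in>{t\<^sub>0..t\<^sub>0 + T}.
        ereal t' < e\<^sub>x \<and> ereal t' < e\<^sub>z \<and>
        (\<forall>t\<in>{t\<^sub>0..t'}. sup_norm \<tau> (segment \<tau> x t) \<le> r \<and> sup_norm \<tau> (segment \<tau> z t) \<le> r) \<longrightarrow>
        (\<forall>t\<in>{t\<^sub>0..t'}. sup_dist \<tau> (segment \<tau> z t) (segment \<tau> x t) \<le> \<epsilon>)))"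
  proof (intro exI conjI allI ballI impI)
    show "\<delta> > 0" by fact
  next
    fix t\<^sub>0 \<psi> u e\<^sub>x x e\<^sub>z z t' t
    assume "0 \<le> t\<^sub>0" "u \<in> inputs" "gamma_norm \<gamma> u \<le> ennreal \<delta>"
      and "maximal_solution \<tau> f t\<^sub>0 \<psi> u e\<^sub>x x \<and> maximal_solution \<tau> f t\<^sub>0 \<psi> (\<lambda>_. 0) e\<^sub>z z"
      and "t' \<in> {t\<^sub>0..t\<^sub>0 + T}"
      and "ereal t' < e\<^sub>x \<and> ereal t' < e\<^sub>z \<and>
        (\<forall>t\<in>{t\<^sub>0..t'}. sup_norm \<tau> (segment \<tau> x t) \<le> r \<and> sup_norm \<tau> (segment \<tau> z t) \<le> r)"
      and "t \<in> {t\<^sub>0..t'}"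
    then show "sup_dist \<tau> (segment \<tau> z t) (segment \<tau> x t) \<le> \<epsilon>"
      by (intro main[of t\<^sub>0 u \<psi> e\<^sub>x x e\<^sub>z z t' t]) (simp_all add: maximal_solution_def)
  qed
qed

end
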